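(* For every graph $G$ of order $n$, $$\mu_n(G)+\mu_n(\overline{G})\le -1-\frac{s^2(G)}{n^3}.$$
   Context: $\mu_n(G)$ is the smallest eigenvalue of the adjacency matrix of $G$; $\overline{G}$ is the complement of $G$. With $m$ the number of edges and $d(u)$ the degree of $u$, $s(G)=\sum_{u\in V(G)}|d(u)-2m/n|$.
   Formalization: The order n is taken to be at least 2: for n = 1 the stated inequality reads 0 ≤ −1 and is false, and for n = 0 there are no eigenvalues. *)

theory Defs
  imports Complex_Main "Jordan_Normal_Form.Spectral_Radius"
begin

text \<open>A finite simple graph is given by its vertex set and its set of edges,
  the edges being two-element sets of vertices.\<close>

definition simple_graph :: "'a set \<Rightarrow> 'a set set \<Rightarrow> bool" where
  "simple_graph V E \<longleftrightarrow> finite V \<and> (\<forall>e\<in>E. e \<subseteq> V \<and> card e = 2)"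

definition complement_edges :: "'a set \<Rightarrow> 'a set set \<Rightarrow> 'a set set" where
  "complement_edges V E = {e. e \<subseteq> V \<and> card e = 2 \<and> e \<notin> E}"

definition vertex_degree :: "'a set set \<Rightarrow> 'a \<Rightarrow> nat" where
  "vertex_degree E u = card {e \<in> E. u \<in> e}"

definition degree_deviation :: "'a set \<Rightarrow> 'a set set \<Rightarrow> real" where
  "degree_deviation V E =
     (\<Sum>u\<in>V. \<bar>real (vertex_degree E u) - 2 * real (card E) / real (card V)\<bar>)"

text \<open>The rows and columns of the adjacency matrix follow an arbitrary enumeration of the
  vertices; its eigenvalues do not depend on the choice.\<close>

definition vertex_list :: "'a set \<Rightarrow> 'a list" where
  "vertex_list V = (SOME vs. distinct vs \<and> set vs = V)"

definition adjacency_matrix :: "'a set \<Rightarrow> 'a set set \<Rightarrow> real mat" where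
  "adjacency_matrix V E =
     mat (card V) (card V)
       (\<lambda>(i, j). if {vertex_list V ! i, vertex_list V ! j} \<in> E then 1 else 0)"

text \<open>The adjacency matrix is real symmetric, so all its complex eigenvalues are real and the
  minimum over its real spectrum is its smallest eigenvalue.  For a graph without vertices the
  spectrum is empty and the value is unspecified.\<close>

definition smallest_eigenvalue :: "'a set \<Rightarrow> 'a set set \<Rightarrow> real" where
  "smallest_eigenvalue V E = Min (spectrum (adjacency_matrix V E))"

end

(* Let d be the degree vector, e its mean, delta = d - e, D = |delta|^2, A the adjacency matrix and
   q = delta^T A delta.  Since delta is orthogonal to the all-ones vector 1 and 1^T A delta = D,
   the Rayleigh quotient of A at 1 - (n^2/D) delta, added to that of the complement at delta, is
   at most -1 - D/n^2, provided that e - q/D <= n/2; otherwise the complement has this property.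
   The bound D <= n^3/4 absorbs the lower-order term, and s^2 <= n D by Cauchy-Schwarz.  A regular
   graph has D = 0; there the test vector e_x - e_y is used for both graphs. *)

theory Submission
  imports Defs "HOL-Analysis.Function_Topology" "HOL-Analysis.Convex"
begin

section \<open>Quadratic forms and the variational bound for the smallest eigenvalue\<close>

text \<open>The kernel \<open>M\<close> is a function on an arbitrary index set, so that matrix
  indices and vertices are treated alike.\<close>

definition quad_form :: "'i set \<Rightarrow> ('i \<Rightarrow> 'i \<Rightarrow> real) \<Rightarrow> ('i \<Rightarrow> real) \<Rightarrow> real" where
  "quad_form V M f = (\<Sum>u\<in>V. \<Sum>v\<in>V. M u v * f u * f v)"

lemma quad_form_scale: "quad_form V M (\<lambda>u. c * f u) = c\<^sup>2 * quad_form V M f"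
  by (simp add: quad_form_def sum_distrib_left power2_eq_square mult_ac)

lemma quad_form_cong: "(\<And>u. u \<in> V \<Longrightarrow> f u = g u) \<Longrightarrow> quad_form V M f = quad_form V M g"
  by (simp add: quad_form_def)

lemma quad_form_add:
  assumes sym: "\<And>u v. u \<in> V \<Longrightarrow> v \<in> V \<Longrightarrow> M u v = M v u"
  shows "quad_form V M (\<lambda>u. f u + t * g u) =
    quad_form V M f + 2 * t * (\<Sum>u\<in>V. g u * (\<Sum>v\<in>V. M u v * f v)) + t\<^sup>2 * quad_form V M g"
proof -
  have swap: "(\<Sum>u\<in>V. \<Sum>v\<in>V. M u v * f u * g v) = (\<Sum>u\<in>V. \<Sum>v\<in>V. M u v * g u * f v)"
    by (subst sum.swap) (intro sum.cong refl, simp add: sym mult_ac)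
  have "quad_form V M (\<lambda>u. f u + t * g u) = quad_form V M f
      + t * (\<Sum>u\<in>V. \<Sum>v\<in>V. M u v * f u * g v) + t * (\<Sum>u\<in>V. \<Sum>v\<in>V. M u v * g u * f v)
      + t\<^sup>2 * quad_form V M g"
    unfolding quad_form_def sum_distrib_left sum.distrib[symmetric]
    by (intro sum.cong refl) (simp add: algebra_simps power2_eq_square)
  then show ?thesis
    unfolding swap by (simp add: sum_distrib_left mult_ac)
qed

text \<open>A nonnegative form that vanishes at \<open>g\<close> is minimal there. If
  \<open>M g\<close> were nonzero, a small step from \<open>g\<close> against \<open>M g\<close>
  would make the form negative.\<close>

lemma quad_form_zero_imp_kernel:
  assumes fin: "finite V"
    and sym: "\<And>u v. u \<in> V \<Longrightarrow> v \<in> V \<Longrightarrow> M u v = M v u"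
    and nonneg: "\<And>f. quad_form V M f \<ge> 0"
    and zero: "quad_form V M g = 0"
    and u: "u \<in> V"
  shows "(\<Sum>v\<in>V. M u v * g v) = 0"
proof -
  define h where "h u = (\<Sum>v\<in>V. M u v * g v)" for u
  define H where "H = (\<Sum>u\<in>V. (h u)\<^sup>2)"
  define q where "q = quad_form V M h"
  have q0: "q \<ge> 0" and H0: "H \<ge> 0"
    using nonneg by (auto simp: q_def H_def sum_nonneg)
  \<comment> \<open>The minimum of \<open>2 * t * H + t^2 * q\<close> lies at
    \<open>- H / q\<close>; the added 1 avoids division by zero when \<open>q = 0\<close> and keeps
    the value negative unless \<open>H = 0\<close>.\<close>
  define t where "t = - H / (q + 1)"
  have "0 \<le> quad_form V M (\<lambda>u. g u + t * h u)" by (rule nonneg)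
  also have "\<dots> = 2 * t * H + t\<^sup>2 * q"
    by (subst quad_form_add, erule (1) sym)
      (simp add: zero h_def[symmetric] H_def q_def power2_eq_square)
  also have "\<dots> = - (H\<^sup>2 * (q + 2) / (q + 1)\<^sup>2)"
    using q0 by (simp add: t_def field_simps power2_eq_square add_nonneg_eq_0_iff)
  finally have "H\<^sup>2 * (q + 2) / (q + 1)\<^sup>2 \<le> 0" by simp
  then have "H = 0"
    using q0 by (auto simp: divide_le_0_iff mult_le_0_iff)
  then show ?thesis
    using fin u by (simp add: H_def sum_nonneg_eq_0_iff h_def)
qed

text \<open>The unit sphere over \<open>V\<close> is compact and the form is continuous; homogeneity
  of degree 2 carries the minimum over to all vectors.\<close>

lemma quad_form_attains_min_on_sphere:
  fixes M :: "'i \<Rightarrow> 'i \<Rightarrow> real"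
  assumes fin: "finite V" and ne: "V \<noteq> {}"
  obtains g where "(\<Sum>u\<in>V. (g u)\<^sup>2) = 1"
    and "\<And>f. quad_form V M g * (\<Sum>u\<in>V. (f u)\<^sup>2) \<le> quad_form V M f"
proof -
  \<comment> \<open>Vectors are functions on the whole type. Pinning the coordinates outside
    \<open>V\<close> to 0 makes the box compact by Tychonoff, and the sphere is closed in
    it.\<close>
  define S :: "'i \<Rightarrow> real set" where "S u = (if u \<in> V then {-1..1} else {0})" for u
  define K where "K = PiE UNIV S \<inter> {f. (\<Sum>u\<in>V. (f u)\<^sup>2) = 1}"
  have "compactin (product_topology (\<lambda>_. euclidean) UNIV) (PiE UNIV S)"
    by (subst compactin_PiE) (auto simp: S_def)
  then have cS: "compact (PiE UNIV S)"
    by (simp add: euclidean_product_topology)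
  have "closed {f :: 'i \<Rightarrow> real. (\<Sum>u\<in>V. (f u)\<^sup>2) = 1}"
    by (intro closed_Collect_eq continuous_intros continuous_on_product_coordinates)
  with cS have cK: "compact K" unfolding K_def by (rule compact_Int_closed)
  obtain w where w: "w \<in> V" using ne by blast
  have "(\<lambda>u. if u = w then 1 else 0) \<in> K"
    using w fin by (auto simp: K_def S_def if_distrib[of "\<lambda>x. x\<^sup>2"] cong: if_cong)
  then have neK: "K \<noteq> {}" by blast
  have "continuous_on K (quad_form V M)"
    unfolding quad_form_def
    by (intro continuous_intros continuous_on_product_coordinates continuous_on_subset[OF continuous_on_product_coordinates]) auto
  then obtain g where g: "g \<in> K" and gmin: "\<And>f. f \<in> K \<Longrightarrow> quad_form V M g \<le> quad_form V M f"
    using continuous_attains_inf[OF cK neK] by blast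
  show ?thesis
  proof
    show "(\<Sum>u\<in>V. (g u)\<^sup>2) = 1" using g by (simp add: K_def)
    fix f :: "'i \<Rightarrow> real"
    define r where "r = (\<Sum>u\<in>V. (f u)\<^sup>2)"
    show "quad_form V M g * (\<Sum>u\<in>V. (f u)\<^sup>2) \<le> quad_form V M f"
    proof (cases "r = 0")
      case True
      then have "\<And>u. u \<in> V \<Longrightarrow> f u = 0"
        using fin by (simp add: r_def sum_nonneg_eq_0_iff)
      then show ?thesis by (simp add: quad_form_def)
    next
      case False
      then have r: "r > 0" by (simp add: r_def sum_nonneg order_less_le)
      \<comment> \<open>Normalizing alone does not reach \<open>K\<close>; \<open>f\<close> must
        also be cut off outside \<open>V\<close>, which the form does not see.\<close>
      define k where "k u = (if u \<in> V then (1 / sqrt r) * f u else 0)" for u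
      have k1: "(\<Sum>u\<in>V. (k u)\<^sup>2) = 1"
        using r by (simp add: k_def power_mult_distrib power_divide sum_divide_distrib[symmetric] r_def[symmetric])
      have "\<bar>k u\<bar> \<le> 1" if "u \<in> V" for u
      proof -
        have "(k u)\<^sup>2 \<le> (\<Sum>u\<in>V. (k u)\<^sup>2)"
          by (rule member_le_sum[OF that _ fin]) simp
        then show ?thesis by (simp add: k1 abs_square_le_1)
      qed
      moreover have "k u = 0" if "u \<notin> V" for u using that by (simp add: k_def)
      ultimately have "k \<in> K" using k1 by (auto simp: K_def S_def abs_le_iff minus_le_iff)
      then have "quad_form V M g \<le> quad_form V M k" by (rule gmin)
      also have "\<dots> = quad_form V M (\<lambda>u. (1 / sqrt r) * f u)"
        by (rule quad_form_cong) (simp add: k_def)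
      also have "\<dots> = quad_form V M f / r"
        unfolding quad_form_scale using r by (simp add: power_divide)
      finally show ?thesis using r by (simp add: r_def field_simps)
    qed
  qed
qed

text \<open>Let \<open>g\<close> minimize the form on the unit sphere, with value \<open>l\<close>.
  The form of \<open>A - l I\<close> is nonnegative and vanishes at \<open>g\<close>, so
  \<open>g\<close> lies in its kernel and is an eigenvector for \<open>l\<close>.\<close>

lemma symmetric_eigenvalue_le_quad_form:
  assumes A: "A \<in> carrier_mat n n" and n: "n > 0"
    and sym: "\<And>i j. i < n \<Longrightarrow> j < n \<Longrightarrow> A $$ (i, j) = A $$ (j, i)"
  obtains l where "eigenvalue A l"
    and "\<And>f. l * (\<Sum>i<n. (f i)\<^sup>2) \<le> quad_form {..<n} (\<lambda>i j. A $$ (i, j)) f"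
proof -
  let ?V = "{..<n}" and ?Q = "quad_form {..<n} (\<lambda>i j. A $$ (i, j))"
  have "?V \<noteq> {}" using n by auto
  then obtain g where g1: "(\<Sum>i\<in>?V. (g i)\<^sup>2) = 1"
    and gmin: "\<And>f. ?Q g * (\<Sum>i\<in>?V. (f i)\<^sup>2) \<le> ?Q f"
    using quad_form_attains_min_on_sphere[of ?V] by blast
  define l where "l = ?Q g"
  define M where "M i j = A $$ (i, j) - (if i = j then l else 0)" for i j
  have QM: "quad_form ?V M f = ?Q f - l * (\<Sum>i\<in>?V. (f i)\<^sup>2)" for f
  proof -
    have "M i j * f i * f j = A $$ (i, j) * f i * f j - (if i = j then l * (f j)\<^sup>2 else 0)" for i j
      by (simp add: M_def algebra_simps power2_eq_square)
    then show ?thesis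
      by (simp add: quad_form_def sum_subtractf sum_distrib_left)
  qed
  have ker: "(\<Sum>j\<in>?V. M i j * g j) = 0" if "i \<in> ?V" for i
  proof (rule quad_form_zero_imp_kernel[OF _ _ _ _ that])
    show "M i j = M j i" if "i \<in> ?V" "j \<in> ?V" for i j
      using that sym by (simp add: M_def)
    show "quad_form ?V M f \<ge> 0" for f using gmin by (simp add: QM l_def)
    show "quad_form ?V M g = 0" using g1 by (simp add: QM l_def)
  qed simp
  have Ag: "(\<Sum>j<n. A $$ (i, j) * g j) = l * g i" if "i < n" for i
  proof -
    have "M i j * g j = A $$ (i, j) * g j - (if i = j then l * g j else 0)" for j
      by (simp add: M_def algebra_simps)
    then show ?thesis using ker[of i] that by (simp add: sum_subtractf)
  qed
  have "eigenvector A (vec n g) l"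
    unfolding eigenvector_def
  proof (intro conjI)
    show "vec n g \<in> carrier_vec (dim_row A)" using A by simp
    show "vec n g \<noteq> 0\<^sub>v (dim_row A)"
    proof
      assume "vec n g = 0\<^sub>v (dim_row A)"
      then have "g i = 0" if "i < n" for i
        using that A by (metis carrier_matD(1) index_vec index_zero_vec(1))
      then show False using g1 by simp
    qed
    show "A *\<^sub>v vec n g = l \<cdot>\<^sub>v vec n g"
      using A Ag by (intro eq_vecI) (auto simp: scalar_prod_def atLeast0LessThan)
  qed
  then show ?thesis
    using that gmin by (auto simp: eigenvalue_def l_def)
qed

section \<open>Adjacency forms of a graph and its complement\<close>

definition adj :: "'a set set \<Rightarrow> 'a \<Rightarrow> 'a \<Rightarrow> real" where
  "adj E u v = (if {u, v} \<in> E then 1 else 0)"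

lemma adj_commute: "adj E u v = adj E v u"
  by (simp add: adj_def insert_commute)

text \<open>The Rayleigh bound holds for some eigenvalue, hence for the minimum of the finite
  spectrum. Reindexing along \<open>vertex_list\<close> then removes the enumeration of the
  vertices.\<close>

lemma smallest_eigenvalue_le_quad_form:
  assumes fin: "finite V" and ne: "V \<noteq> {}"
  shows "smallest_eigenvalue V E * (\<Sum>u\<in>V. (f u)\<^sup>2) \<le> quad_form V (adj E) f"
proof -
  let ?n = "card V" and ?A = "adjacency_matrix V E" and ?vs = "vertex_list V"
  have "distinct ?vs \<and> set ?vs = V"
    unfolding vertex_list_def by (rule someI_ex) (metis fin finite_distinct_list)
  then have "bij_betw ((!) ?vs) {..<?n} V"
    by (metis bij_betw_nth distinct_card)
  then have reindex: "(\<Sum>u\<in>V. F u) = (\<Sum>i<?n. F (?vs ! i))" for F :: "'a \<Rightarrow> real"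
    by (simp add: sum.reindex_bij_betw)
  have A: "?A \<in> carrier_mat ?n ?n" by (simp add: adjacency_matrix_def)
  have Aij: "?A $$ (i, j) = adj E (?vs ! i) (?vs ! j)" if "i < ?n" "j < ?n" for i j
    using that by (simp add: adjacency_matrix_def adj_def)
  have "?n > 0" using fin ne by (simp add: card_gt_0_iff)
  then obtain l where l: "eigenvalue ?A l"
    and ray: "\<And>f. l * (\<Sum>i<?n. (f i)\<^sup>2) \<le> quad_form {..<?n} (\<lambda>i j. ?A $$ (i, j)) f"
    by (rule symmetric_eigenvalue_le_quad_form[OF A]) (auto simp: Aij adj_commute)
  have "smallest_eigenvalue V E \<le> l"
    unfolding smallest_eigenvalue_def
    using l card_finite_spectrum(1)[OF A] by (intro Min_le) (auto simp: spectrum_def)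
  then have "smallest_eigenvalue V E * (\<Sum>u\<in>V. (f u)\<^sup>2) \<le> l * (\<Sum>u\<in>V. (f u)\<^sup>2)"
    by (intro mult_right_mono sum_nonneg) auto
  also have "\<dots> \<le> quad_form V (adj E) f"
    using ray[of "\<lambda>i. f (?vs ! i)"] by (simp add: quad_form_def reindex Aij)
  finally show ?thesis .
qed

lemma sum_adj_eq_vertex_degree:
  assumes "simple_graph V E" and u: "u \<in> V"
  shows "(\<Sum>v\<in>V. adj E u v) = real (vertex_degree E u)"
proof -
  have fin: "finite V" and E: "\<And>e. e \<in> E \<Longrightarrow> e \<subseteq> V \<and> card e = 2"
    using assms by (auto simp: simple_graph_def)
  have "bij_betw (\<lambda>v. {u, v}) {v \<in> V. {u, v} \<in> E} {e \<in> E. u \<in> e}"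
    unfolding bij_betw_def
  proof (intro conjI equalityI subsetI)
    show "inj_on (\<lambda>v. {u, v}) {v \<in> V. {u, v} \<in> E}"
      by (auto simp: inj_on_def doubleton_eq_iff)
  next
    fix e assume e: "e \<in> {e \<in> E. u \<in> e}"
    then obtain v where "e = {u, v}"
      using E by (auto simp: card_2_iff doubleton_eq_iff)
    then show "e \<in> (\<lambda>v. {u, v}) ` {v \<in> V. {u, v} \<in> E}"
      using e E by blast
  qed auto
  then have "vertex_degree E u = card {v \<in> V. {u, v} \<in> E}"
    by (simp add: vertex_degree_def bij_betw_same_card)
  then show ?thesis
    using fin by (simp add: adj_def sum.If_cases Int_def)
qed

text \<open>Handshake lemma, by double counting of incidences: every edge has two ends.\<close>

lemma sum_vertex_degree:
  assumes "simple_graph V E"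
  shows "(\<Sum>u\<in>V. real (vertex_degree E u)) = 2 * real (card E)"
proof -
  have fin: "finite V" and E: "\<And>e. e \<in> E \<Longrightarrow> e \<subseteq> V \<and> card e = 2"
    using assms by (auto simp: simple_graph_def)
  have finE: "finite E"
    by (rule finite_subset[of _ "Pow V"]) (use E fin in auto)
  have "{u \<in> V. u \<in> e} = e" if "e \<in> E" for e using E[OF that] by blast
  then have "(\<Sum>u\<in>V. vertex_degree E u) = 2 * card E"
    unfolding vertex_degree_def
    using sum_multicount[OF fin finE, of "(\<in>)" 2] E by auto
  then show ?thesis
    by (metis of_nat_mult of_nat_numeral of_nat_sum)
qed

lemma simple_graph_complement:
  "simple_graph V E \<Longrightarrow> simple_graph V (complement_edges V E)"
  by (auto simp: simple_graph_def complement_edges_def)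

text \<open>Entrywise form of J - I - A, with J the all-ones matrix. On the diagonal
  \<open>{u, u}\<close> is a singleton and so an edge of neither graph.\<close>

lemma adj_complement:
  assumes "simple_graph V E" "u \<in> V" "v \<in> V"
  shows "adj (complement_edges V E) u v = 1 - adj E u v - (if u = v then 1 else 0)"
  using assms by (auto simp: adj_def complement_edges_def simple_graph_def card_insert_if)

text \<open>In J - I - A the form of J is the square of the coordinate sum, which vanishes
  here.\<close>

lemma quad_form_complement:
  assumes "simple_graph V E" and zero: "(\<Sum>u\<in>V. f u) = 0"
  shows "quad_form V (adj (complement_edges V E)) f = - (\<Sum>u\<in>V. (f u)\<^sup>2) - quad_form V (adj E) f"
proof -
  have fin: "finite V" using assms by (simp add: simple_graph_def)
  have "quad_form V (adj (complement_edges V E)) f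
      = (\<Sum>u\<in>V. \<Sum>v\<in>V. f u * f v - adj E u v * f u * f v - (if u = v then (f u)\<^sup>2 else 0))"
    unfolding quad_form_def
    by (intro sum.cong refl) (simp add: adj_complement[OF assms(1)] algebra_simps power2_eq_square)
  also have "\<dots> = (\<Sum>u\<in>V. f u) * (\<Sum>v\<in>V. f v) - quad_form V (adj E) f - (\<Sum>u\<in>V. (f u)\<^sup>2)"
    by (simp add: sum_subtractf sum_product quad_form_def fin)
  finally show ?thesis by (simp add: zero)
qed

section \<open>Degree deviations and the bound they give on the eigenvalue sum\<close>

definition mean_degree :: "'a set \<Rightarrow> 'a set set \<Rightarrow> real" where
  "mean_degree V E = 2 * real (card E) / real (card V)"

definition deviation :: "'a set \<Rightarrow> 'a set set \<Rightarrow> 'a \<Rightarrow> real" where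
  "deviation V E u = real (vertex_degree E u) - mean_degree V E"

lemma vertex_degree_complement:
  assumes "simple_graph V E" "u \<in> V"
  shows "real (vertex_degree (complement_edges V E) u) = real (card V) - 1 - real (vertex_degree E u)"
proof -
  have "finite V" using assms by (simp add: simple_graph_def)
  then have "(\<Sum>v\<in>V. adj (complement_edges V E) u v) = real (card V) - 1 - (\<Sum>v\<in>V. adj E u v)"
    using assms(2) by (simp add: adj_complement[OF assms] sum_subtractf)
  then show ?thesis
    using assms by (simp add: sum_adj_eq_vertex_degree simple_graph_complement)
qed

lemma sum_vertex_degree_eq_mean:
  assumes "simple_graph V E" "V \<noteq> {}"
  shows "(\<Sum>u\<in>V. real (vertex_degree E u)) = card V * mean_degree V E"
  using assms by (simp add: sum_vertex_degree mean_degree_def simple_graph_def)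

lemma sum_deviation:
  assumes "simple_graph V E" "V \<noteq> {}"
  shows "(\<Sum>u\<in>V. deviation V E u) = 0"
  using assms by (simp add: deviation_def sum_subtractf sum_vertex_degree_eq_mean)

lemma mean_degree_complement:
  assumes "simple_graph V E" "V \<noteq> {}"
  shows "mean_degree V (complement_edges V E) = real (card V) - 1 - mean_degree V E"
proof -
  have n: "card V > 0" using assms by (simp add: simple_graph_def card_gt_0_iff)
  have "card V * mean_degree V (complement_edges V E) = card V * (real (card V) - 1 - mean_degree V E)"
    using assms sum_vertex_degree_eq_mean[OF assms]
    by (simp add: sum_vertex_degree_eq_mean[OF simple_graph_complement[OF assms(1)] assms(2), symmetric]
        vertex_degree_complement sum_subtractf algebra_simps)
  then show ?thesis using n by simp
qed

text \<open>Complementation reflects the degrees and their mean in (n - 1)/2. Hence both graphs have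
  the same sum of squared deviations.\<close>

lemma deviation_complement:
  assumes "simple_graph V E" "u \<in> V"
  shows "deviation V (complement_edges V E) u = - deviation V E u"
  using assms mean_degree_complement[OF assms(1)]
  by (force simp: deviation_def vertex_degree_complement)

text \<open>A variance bound for values in the interval from 0 to n: their variance is at most e (n
  - e), with e the mean, and so at most n^2/4.\<close>

lemma sum_deviation_squares_le:
  assumes G: "simple_graph V E" and ne: "V \<noteq> {}"
  shows "(\<Sum>u\<in>V. (deviation V E u)\<^sup>2) \<le> real (card V) ^ 3 / 4"
proof -
  let ?n = "real (card V)" and ?e = "mean_degree V E"
  have le: "real (vertex_degree E u) \<le> ?n" if "u \<in> V" for u
    using vertex_degree_complement[OF G that] of_nat_0_le_iff[of "vertex_degree (complement_edges V E) u", where ?'a=real] by linarith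
  \<comment> \<open>The added terms sum to zero; with this coefficient the termwise inequality below
    is equivalent to d (n - d) >= 0.\<close>
  have "(\<Sum>u\<in>V. (deviation V E u)\<^sup>2) = (\<Sum>u\<in>V. (deviation V E u)\<^sup>2 + (2 * ?e - ?n) * deviation V E u)"
    by (simp add: sum.distrib sum_distrib_left[symmetric] sum_deviation[OF G ne])
  also have "\<dots> \<le> (\<Sum>u\<in>V. ?e * (?n - ?e))"
  proof (rule sum_mono)
    fix u assume u: "u \<in> V"
    define d where "d = real (vertex_degree E u)"
    have "0 \<le> d * (?n - d)" using le[OF u] by (simp add: d_def)
    then show "(deviation V E u)\<^sup>2 + (2 * ?e - ?n) * deviation V E u \<le> ?e * (?n - ?e)"
      by (simp add: deviation_def d_def[symmetric] algebra_simps power2_eq_square)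
  qed
  also have "\<dots> = ?n * (?e * (?n - ?e))" by simp
  also have "\<dots> \<le> ?n * (?n\<^sup>2 / 4)"
    using zero_le_power2[of "?n - 2 * ?e"]
    by (intro mult_left_mono) (simp_all add: algebra_simps power2_eq_square)
  finally show ?thesis by (simp add: power3_eq_cube power2_eq_square)
qed

text \<open>With \<open>q\<close> the quadratic form at the deviation vector, the parameter \<open>a = mean - q / D\<close> of a graph and that of its complement
  add up to \<open>n\<close>, so one of the two graphs satisfies the hypothesis \<open>a \<le> n / 2\<close>.\<close>

lemma smallest_eigenvalue_sum_le:
  fixes E :: "'a set set"
  assumes G: "simple_graph V E" and ne: "V \<noteq> {}"
  defines "n \<equiv> real (card V)"
    and "D \<equiv> \<Sum>u\<in>V. (deviation V E u)\<^sup>2"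
    and "q \<equiv> quad_form V (adj E) (deviation V E)"
  assumes D: "D > 0"
    and l': "l' * D \<le> - D - q"
    and a: "mean_degree V E - q / D \<le> n / 2"
  shows "smallest_eigenvalue V E + l' \<le> - 1 - D / n\<^sup>2"
proof -
  let ?l = "smallest_eigenvalue V E" and ?e = "mean_degree V E" and ?\<delta> = "deviation V E"
  have fin: "finite V" using G by (simp add: simple_graph_def)
  have n: "n > 0" using fin ne by (simp add: n_def card_gt_0_iff)
  define t where "t = - (n\<^sup>2 / D)"
  have norm: "(\<Sum>u\<in>V. (1 + t * ?\<delta> u)\<^sup>2) = n + t\<^sup>2 * D"
  proof -
    have "(\<Sum>u\<in>V. (1 + t * ?\<delta> u)\<^sup>2) = (\<Sum>u\<in>V. 1 + 2 * t * ?\<delta> u + t\<^sup>2 * (?\<delta> u)\<^sup>2)"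
      by (simp add: power2_sum power_mult_distrib mult_ac)
    then show ?thesis
      by (simp add: sum.distrib sum_distrib_left[symmetric] sum_deviation[OF G ne] n_def D_def)
  qed
  have row: "(\<Sum>v\<in>V. adj E u v * 1) = ?\<delta> u + ?e" if "u \<in> V" for u
    using that by (simp add: sum_adj_eq_vertex_degree[OF G] deviation_def)
  have ones: "quad_form V (adj E) (\<lambda>_. 1) = n * ?e"
    using row by (simp add: quad_form_def sum.distrib sum_deviation[OF G ne] n_def)
  have cross: "(\<Sum>u\<in>V. ?\<delta> u * (\<Sum>v\<in>V. adj E u v * 1)) = D"
  proof -
    have "(\<Sum>u\<in>V. ?\<delta> u * (\<Sum>v\<in>V. adj E u v * 1)) = (\<Sum>u\<in>V. (?\<delta> u)\<^sup>2 + ?\<delta> u * ?e)"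
      by (intro sum.cong refl) (simp only: row, simp add: algebra_simps power2_eq_square)
    then show ?thesis
      by (simp add: sum.distrib sum_distrib_right[symmetric] sum_deviation[OF G ne] D_def)
  qed
  have "?l * (n + t\<^sup>2 * D) \<le> n * ?e + 2 * t * D + t\<^sup>2 * q"
    using smallest_eigenvalue_le_quad_form[OF fin ne, of E "\<lambda>u. 1 + t * ?\<delta> u"]
    unfolding norm quad_form_add[of V "adj E", OF adj_commute] ones cross q_def .
  \<comment> \<open>The factor \<open>D / n\<close> turns the squared norm into
    \<open>D + n ^ 3\<close>, the cross term into \<open>- 2 * n * D\<close>, and the coefficient of
    \<open>q / D\<close> into \<open>n ^ 3\<close>.\<close>
  then have "(?l * (n + t\<^sup>2 * D)) * (D / n) \<le> (n * ?e + 2 * t * D + t\<^sup>2 * q) * (D / n)"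
    using D n by (intro mult_right_mono) auto
  moreover have "(?l * (n + t\<^sup>2 * D)) * (D / n) = ?l * (D + n ^ 3)"
    using D n by (simp add: t_def field_simps power2_eq_square power3_eq_cube)
  moreover have "(n * ?e + 2 * t * D + t\<^sup>2 * q) * (D / n) = ?e * D - 2 * n * D + n ^ 3 * (q / D)"
    using D n by (simp add: t_def field_simps power2_eq_square power3_eq_cube)
  ultimately have l: "?l * (D + n ^ 3) \<le> ?e * D - 2 * n * D + n ^ 3 * (q / D)" by simp
  \<comment> \<open>\<open>l'\<close> stands for the smallest eigenvalue of the complement, known
    only through its Rayleigh bound at the deviation vector. Leaving it abstract allows the two
    graphs to exchange roles.\<close>
  have "l' \<le> - 1 - q / D" using l' D by (simp add: field_simps)
  then have "(l' + 1) * (D + n ^ 3) \<le> - (q / D) * (D + n ^ 3)"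
    using D n by (intro mult_right_mono) auto
  \<comment> \<open>The terms \<open>n ^ 3 * (q / D)\<close> cancel, which leaves a multiple of
    \<open>D\<close>.\<close>
  with l have "(?l + l' + 1) * (D + n ^ 3) \<le> D * (?e - q / D - 2 * n)"
    by (simp add: algebra_simps)
  also have "\<dots> \<le> D * (- 3 / 2 * n)"
  proof (rule mult_left_mono)
    show "?e - q / D - 2 * n \<le> - 3 / 2 * n" using a by linarith
  qed (use D in simp)
  also have "\<dots> = - (D / n\<^sup>2) * (3 / 2 * n ^ 3)"
    using n by (simp add: field_simps power2_eq_square power3_eq_cube)
  \<comment> \<open>Since D <= n^3/4, the left factor 3/2 n^3 exceeds
    \<open>D + n ^ 3\<close>.\<close>
  also have "\<dots> \<le> - (D / n\<^sup>2) * (D + n ^ 3)"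
  proof -
    have "D + n ^ 3 \<le> 3 / 2 * n ^ 3"
    proof -
      have "n ^ 3 > 0" using n by simp
      then show ?thesis
        using sum_deviation_squares_le[OF G ne] unfolding D_def[symmetric] n_def[symmetric]
        by linarith
    qed
    then have "(D / n\<^sup>2) * (D + n ^ 3) \<le> (D / n\<^sup>2) * (3 / 2 * n ^ 3)"
      using D by (intro mult_left_mono) auto
    then show ?thesis by simp
  qed
  finally have "?l + l' + 1 \<le> - (D / n\<^sup>2)"
    by (rule mult_right_le_imp_le) (use D n in \<open>simp add: add_pos_pos\<close>)
  then show ?thesis by simp
qed

theorem theorem13:
  fixes V :: "'a set" and E :: "'a set set" and n :: nat
  assumes "simple_graph V E"
    and "card V = n"
    and "n \<ge> 2"
  shows "smallest_eigenvalue V E + smallest_eigenvalue V (complement_edges V E)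
           \<le> - 1 - (degree_deviation V E)\<^sup>2 / real n ^ 3"
proof -
  let ?F = "complement_edges V E" and ?\<delta> = "deviation V E"
  let ?l = "smallest_eigenvalue V E" and ?l' = "smallest_eigenvalue V ?F"
  define D where "D = (\<Sum>u\<in>V. (?\<delta> u)\<^sup>2)"
  define q where "q = quad_form V (adj E) ?\<delta>"
  note G = assms(1)
  note F = simple_graph_complement[OF G]
  have fin: "finite V" using G by (simp add: simple_graph_def)
  have ne: "V \<noteq> {}" using assms by auto
  have D0: "D \<ge> 0" by (simp add: D_def sum_nonneg)
  have "(degree_deviation V E)\<^sup>2 = (\<Sum>u\<in>V. \<bar>?\<delta> u\<bar>)\<^sup>2"
    by (simp add: degree_deviation_def deviation_def mean_degree_def)
  also have "\<dots> \<le> (\<Sum>u\<in>V. \<bar>?\<delta> u\<bar>\<^sup>2) * card V"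
    by (rule sum_squared_le_sum_of_squares)
  finally have "(degree_deviation V E)\<^sup>2 / real n ^ 3 \<le> (D * n) / real n ^ 3"
    by (intro divide_right_mono) (simp_all add: D_def assms(2))
  also have "\<dots> = D / (real n)\<^sup>2"
    using assms(3) by (simp add: field_simps power2_eq_square power3_eq_cube)
  finally have s: "(degree_deviation V E)\<^sup>2 / real n ^ 3 \<le> D / (real n)\<^sup>2" .
  have comp: "quad_form V (adj ?F) ?\<delta> = - D - q"
    unfolding D_def q_def by (rule quad_form_complement[OF G sum_deviation[OF G ne]])
  have "?l + ?l' \<le> - 1 - D / (real n)\<^sup>2"
  proof (cases "D = 0")
    case True
    obtain x y where xy: "x \<in> V" "y \<in> V" "x \<noteq> y"
      using assms(2,3) by (metis card_le_Suc0_iff_eq fin not_less_eq_eq numeral_2_eq_2)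
    \<comment> \<open>Since \<open>f\<close> sums to zero, its two forms add up to minus its squared
      norm 2. The two Rayleigh bounds thus give \<open>?l + ?l' \<le> - 1\<close>, the claim for
      \<open>D = 0\<close>.\<close>
    define f :: "'a \<Rightarrow> real" where "f u = (if u = x then 1 else 0) - (if u = y then 1 else 0)" for u
    have f0: "(\<Sum>u\<in>V. f u) = 0"
      using fin xy by (simp add: f_def sum_subtractf)
    have f2: "(f u)\<^sup>2 = (if u = x then 1 else 0) + (if u = y then 1 else 0)" for u
      using xy by (simp add: f_def)
    have "(\<Sum>u\<in>V. (f u)\<^sup>2) = 2"
      unfolding f2 using fin xy by (simp add: sum.distrib)
    then show ?thesis
      using True smallest_eigenvalue_le_quad_form[OF fin ne, of E f]
        smallest_eigenvalue_le_quad_form[OF fin ne, of ?F f] quad_form_complement[OF G f0]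
      by simp
  next
    case False
    with D0 have D: "D > 0" by simp
    have l: "?l * D \<le> q"
      unfolding D_def q_def by (rule smallest_eigenvalue_le_quad_form[OF fin ne])
    have l': "?l' * D \<le> - D - q"
      using smallest_eigenvalue_le_quad_form[OF fin ne, of ?F ?\<delta>]
      unfolding comp D_def[symmetric] .
    have D': "(\<Sum>u\<in>V. (deviation V ?F u)\<^sup>2) = D"
      by (simp add: D_def deviation_complement[OF G])
    have q': "quad_form V (adj ?F) (deviation V ?F) = - D - q"
      unfolding comp[symmetric] by (simp add: quad_form_def deviation_complement[OF G])
    show ?thesis
    proof (cases "mean_degree V E - q / D \<le> n / 2")
      case True
      then show ?thesis
        using smallest_eigenvalue_sum_le[OF G ne, of ?l'] D l' assms(2)
        by (simp add: D_def q_def)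
    next
      case False
      \<comment> \<open>With e the mean degree, the parameter of the complement is (n - 1 - e) + 1 +
        q/D = n - (e - q/D), which is below n/2 in this case.\<close>
      have "(- D - q) / D = - 1 - q / D" using D by (simp add: field_simps)
      then have "mean_degree V ?F - (- D - q) / D \<le> n / 2"
        using False by (simp add: mean_degree_complement[OF G ne] assms(2))
      \<comment> \<open>With the roles exchanged, \<open>- D - q\<close> takes the place of
        \<open>q\<close>, and the hypothesis on \<open>l'\<close> becomes the bound
        \<open>?l * D \<le> q\<close>.\<close>
      then show ?thesis
        using smallest_eigenvalue_sum_le[OF F ne, of ?l, unfolded D' q'] D l assms(2)
        by (simp add: add.commute)
    qed
  qed
  with s show ?thesis by linarith
qed

end
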